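(* Let $\prec$ be a Newton ordering on the monomials of $K[\mathbf{x}]=K[x_1,\ldots,x_n]$. Then $\prec$ is noetherian.
   Context: $K$ is a field, $n\ge 1$, $\mathbb{N}=\{0,1,2,\ldots\}$, $\mathcal{M}=\{\mathbf{x}^{\alpha}\mid\alpha\in\mathbb{N}^n\}$ is the set of monomials of $K[\mathbf{x}]$. For a total ordering $\prec$ on $\mathcal{M}$ (not necessarily compatible with multiplication) and nonzero $f\in K[\mathbf{x}]$, $LM(f)$ is the $\prec$-largest monomial occurring in $f$ with nonzero coefficient. For a finite set $G\subset K[\mathbf{x}]$, $L(G)=\{LM(\mathbf{x}^\alpha g)\mid \mathbf{x}^\alpha\in\mathcal{M}, g\in G\}$; for an ideal $I\subseteq K[\mathbf{x}]$, $L(I)=\{LM(g)\mid g\in I\}$ (nonzero $g$ only). A nonempty set of monomials of the form $L(G)$ or $L(I)$ is called a lead monomial set. $\prec$ is noetherian if every increasing sequence of lead monomial sets $L_0\subseteq L_1\subseteq L_2\subseteq\cdots$ becomes stationary. Newton orderings: let $\mathcal{L}$ be a nonempty finite set of nonzero linear forms $l\colon\mathbb{R}^n\to\mathbb{R}$ and $\delta\in\mathbb{Q}_{\ge0}^n$. Assume $\mathcal{L}$ is rational: for each $l\in\mathcal{L}$ the cone $C(l)=\{\alpha\in\mathbb{R}_{\ge0}^n\mid l(\alpha)=\min_{l'\in\mathcal{L}}l'(\alpha)\}$ is the locus where some finite set of linear forms with rational coefficients is nonnegative. Put $w_\delta(\mathbf{x}^\alpha)=\min\{l(\alpha+\delta)\mid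 l\in\mathcal{L}\}$. Let $\prec_0$ be any semigroup ordering on $\mathcal{M}$ (a total ordering compatible with multiplication). Define $\mathbf{x}^\alpha\prec\mathbf{x}^\beta$ iff $w_\delta(\mathbf{x}^\alpha)>w_\delta(\mathbf{x}^\beta)$, or $w_\delta(\mathbf{x}^\alpha)=w_\delta(\mathbf{x}^\beta)$ and $\mathbf{x}^\alpha\prec_0\mathbf{x}^\beta$. An ordering arising in this way is called a Newton ordering. *)

theory Defs
  imports "HOL-Analysis.Analysis" "HOL-Library.Poly_Mapping"
begin

(* Monomials x^\<alpha> are written additively, as exponent vectors; the finite type 'n indexes the
   variables, so n = CARD('n) \<ge> 1. *)

type_synonym 'n monomial = "'n \<Rightarrow>\<^sub>0 nat"
type_synonym ('n, 'k) mpoly = "('n \<Rightarrow>\<^sub>0 nat) \<Rightarrow>\<^sub>0 'k"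

definition total_ordering :: "('a \<Rightarrow> 'a \<Rightarrow> bool) \<Rightarrow> bool" where
  "total_ordering prec \<longleftrightarrow> irreflp prec \<and> transp prec \<and> totalp prec"

definition semigroup_ordering :: "('n monomial \<Rightarrow> 'n monomial \<Rightarrow> bool) \<Rightarrow> bool" where
  "semigroup_ordering prec \<longleftrightarrow>
     total_ordering prec \<and> (\<forall>a b c. prec a b \<longrightarrow> prec (a + c) (b + c))"


subsection \<open>Lead monomial sets\<close>

(* Only meaningful for a total ordering and f \<noteq> 0. *)
definition LM :: "('n monomial \<Rightarrow> 'n monomial \<Rightarrow> bool) \<Rightarrow> ('n, 'k::field) mpoly \<Rightarrow> 'n monomial" where
  "LM prec f = (THE m. m \<in> Poly_Mapping.keys f \<and> (\<forall>m'\<in>Poly_Mapping.keys f. m' \<noteq> m \<longrightarrow> prec m' m))"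

definition lead_of_finite ::
    "('n monomial \<Rightarrow> 'n monomial \<Rightarrow> bool) \<Rightarrow> ('n, 'k::field) mpoly set \<Rightarrow> 'n monomial set" where
  "lead_of_finite prec G =
     {LM prec (Poly_Mapping.single \<alpha> 1 * g) | \<alpha> g. g \<in> G \<and> g \<noteq> 0}"

definition lead_of_ideal ::
    "('n monomial \<Rightarrow> 'n monomial \<Rightarrow> bool) \<Rightarrow> ('n, 'k::field) mpoly set \<Rightarrow> 'n monomial set" where
  "lead_of_ideal prec I = {LM prec g | g. g \<in> I \<and> g \<noteq> 0}"

(* An ideal is a submodule of the ring regarded as a module over itself. *)
abbreviation poly_ideal :: "('n, 'k::field) mpoly set \<Rightarrow> bool" where
  "poly_ideal I \<equiv> module.subspace (*) I"

lemma poly_ideal_iff: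
  fixes I :: "('n, 'k::field) mpoly set"
  shows "poly_ideal I \<longleftrightarrow>
    0 \<in> I \<and> (\<forall>f\<in>I. \<forall>g\<in>I. f + g \<in> I) \<and> (\<forall>h. \<forall>f\<in>I. h * f \<in> I)"
proof -
  interpret module "(*) :: ('n, 'k) mpoly \<Rightarrow> _"
    by standard (simp_all add: algebra_simps)
  show ?thesis unfolding subspace_def by blast
qed

(* The coefficient field enters only through the polynomials, hence the itself argument. *)
definition lead_monomial_set ::
    "'k::field itself \<Rightarrow> ('n monomial \<Rightarrow> 'n monomial \<Rightarrow> bool) \<Rightarrow> 'n monomial set \<Rightarrow> bool" where
  "lead_monomial_set K prec S \<longleftrightarrow> S \<noteq> {} \<and>
     ((\<exists>G :: ('n, 'k) mpoly set. finite G \<and> S = lead_of_finite prec G) \<or>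
      (\<exists>I :: ('n, 'k) mpoly set. poly_ideal I \<and> S = lead_of_ideal prec I))"

definition noetherian_ordering ::
    "'k::field itself \<Rightarrow> ('n monomial \<Rightarrow> 'n monomial \<Rightarrow> bool) \<Rightarrow> bool" where
  "noetherian_ordering K prec \<longleftrightarrow>
     (\<forall>L :: nat \<Rightarrow> 'n monomial set.
        (\<forall>i. lead_monomial_set K prec (L i)) \<and> (\<forall>i. L i \<subseteq> L (Suc i)) \<longrightarrow>
        (\<exists>N. \<forall>i\<ge>N. L i = L N))"


subsection \<open>Newton orderings\<close>

definition exponent_vector :: "'n::finite monomial \<Rightarrow> real ^ 'n" where
  "exponent_vector \<alpha> = (\<chi> i. real (Poly_Mapping.lookup \<alpha> i))"

definition rational_linear_form :: "(real ^ 'n::finite \<Rightarrow> real) \<Rightarrow> bool" where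
  "rational_linear_form l \<longleftrightarrow> linear l \<and> (\<forall>i. l (axis i 1) \<in> \<rat>)"

definition min_cone ::
    "(real ^ 'n::finite \<Rightarrow> real) set \<Rightarrow> (real ^ 'n \<Rightarrow> real) \<Rightarrow> (real ^ 'n) set" where
  "min_cone F l = {\<alpha>. (\<forall>i. 0 \<le> \<alpha> $ i) \<and> l \<alpha> = Min ((\<lambda>l'. l' \<alpha>) ` F)}"

definition rational_family :: "(real ^ 'n::finite \<Rightarrow> real) set \<Rightarrow> bool" where
  "rational_family F \<longleftrightarrow>
     (\<forall>l\<in>F. \<exists>R. finite R \<and> (\<forall>r\<in>R. rational_linear_form r) \<and>
        min_cone F l = {\<alpha>. \<forall>r\<in>R. 0 \<le> r \<alpha>})"

definition newton_weight ::
    "(real ^ 'n::finite \<Rightarrow> real) set \<Rightarrow> real ^ 'n \<Rightarrow> 'n monomial \<Rightarrow> real" where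
  "newton_weight F \<delta> \<alpha> = Min ((\<lambda>l. l (exponent_vector \<alpha> + \<delta>)) ` F)"

definition newton_ordering :: "('n::finite monomial \<Rightarrow> 'n monomial \<Rightarrow> bool) \<Rightarrow> bool" where
  "newton_ordering prec \<longleftrightarrow>
     (\<exists>F \<delta> prec0.
        finite F \<and> F \<noteq> {} \<and> (\<forall>l\<in>F. linear l \<and> l \<noteq> (\<lambda>_. 0)) \<and> rational_family F \<and>
        (\<forall>i. \<delta> $ i \<in> \<rat> \<and> 0 \<le> \<delta> $ i) \<and>
        semigroup_ordering prec0 \<and>
        (\<forall>a b. prec a b \<longleftrightarrow>
           newton_weight F \<delta> a > newton_weight F \<delta> b \<or>
           newton_weight F \<delta> a = newton_weight F \<delta> b \<and> prec0 a b))"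

lemma newton_ordering_total:
  assumes "newton_ordering prec"
  shows "total_ordering prec"
proof -
  from assms obtain w :: "_ \<Rightarrow> real" and prec0 where p0: "total_ordering prec0"
    and p: "\<And>a b. prec a b \<longleftrightarrow> w a > w b \<or> w a = w b \<and> prec0 a b"
    unfolding newton_ordering_def semigroup_ordering_def by metis
  have "irreflp prec"
    using p0 unfolding total_ordering_def irreflp_def p by auto
  moreover have "transp prec"
    unfolding transp_def p
    using p0 unfolding total_ordering_def transp_def by (metis less_trans)
  moreover have "totalp prec"
    unfolding totalp_on_def p
    using p0 unfolding total_ordering_def totalp_on_def by (metis linorder_less_linear UNIV_I)
  ultimately show ?thesis unfolding total_ordering_def by blast
qed

end

theory Submission imports Defs begin

text \<open>
  Let \<open>w\<close> be the weight of the ordering, a minimum over a finite family \<open>F\<close> of linear forms. The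
  cones of \<open>F\<close> subdivide the orthant, and on each of them \<open>w\<close> is given by a single form.
  Two facts make the ordering noetherian.

  First, although the ordering is not compatible with multiplication, it is compatible within each
  cone: if \<open>\<alpha> + \<delta>\<close> and \<open>\<beta>\<close> lie in the same cone, then passing from \<open>\<alpha>\<close> to \<open>\<alpha> + \<beta>\<close> raises the
  weight by exactly \<open>l \<beta>\<close>, whereas every other monomial gains at least \<open>l \<beta>\<close>, because a minimum of
  linear forms is superadditive. As smaller weight means larger monomial, every monomial below \<open>\<alpha>\<close>
  stays below it after multiplication by \<open>\<beta>\<close> (\<open>newton_less_shift\<close>), so if \<open>\<alpha>\<close> leads a polynomial,
  then \<open>\<alpha> + \<beta>\<close> leads its multiple (\<open>LM_shift\<close>). Hence every lead monomial set is upward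
  closed for the relation \<open>cone_shift\<close>, which allows precisely these translations.

  Second, this relation admits no bad sequences. A sequence of monomials visits one cone infinitely
  often; that cone is cut out by finitely many rational forms, whose values at the points
  \<open>\<alpha> + \<delta>\<close> are nonnegative with bounded denominators. Dickson's lemma, applied to the vectors of
  these values, gives a subsequence along which all of them grow, and then the differences of its
  members lie in the cone (\<open>cone_shift_subsequence\<close>). Working with the inequalities of the cone
  in this way avoids finding generators of its monoid of lattice points.

  Finally, upward closed sets for a relation without bad sequences satisfy the ascending chain
  condition (\<open>upward_closed_chain_stationary\<close>).
\<close>

section \<open>Well-quasi-orders and ascending chains\<close>

lemma nat_mono_subsequence:
  fixes f :: "nat \<Rightarrow> nat"
  shows "\<exists>s :: nat \<Rightarrow> nat. strict_mono s \<and> mono (f \<circ> s)"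
proof -
  obtain s :: "nat \<Rightarrow> nat" where s: "strict_mono s" "monoseq (\<lambda>n. f (s n))"
    using seq_monosub by blast
  show ?thesis
  proof (cases "incseq (\<lambda>n. f (s n))")
    case True
    then show ?thesis using s(1) unfolding comp_def by blast
  next
    case False
    then have dec: "decseq (\<lambda>n. f (s n))" using s(2) by (auto simp: monoseq_iff)
    \<comment> \<open>A decreasing sequence of naturals is constant from the first place of its minimum on.\<close>
    obtain m where m: "\<And>n. f (s m) \<le> f (s n)"
      using ex_has_least_nat[of "\<lambda>_. True" 0 "\<lambda>n. f (s n)"] by auto
    have "f (s (m + n)) = f (s m)" for n
      using m[of "m + n"] decseqD[OF dec, of m "m + n"] by simp
    then have "mono (f \<circ> (\<lambda>n. s (m + n)))" by (auto simp: mono_def)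
    moreover have "strict_mono (\<lambda>n. s (m + n))" using s(1) by (auto simp: strict_mono_def)
    ultimately show ?thesis by blast
  qed
qed

text \<open>Dickson's lemma, in the form that passes to subsequences one coordinate after the other.\<close>

lemma Dickson_mono_subsequence:
  fixes f :: "'r \<Rightarrow> nat \<Rightarrow> nat"
  assumes "finite R"
  shows "\<exists>s :: nat \<Rightarrow> nat. strict_mono s \<and> (\<forall>r\<in>R. mono (f r \<circ> s))"
  using assms
proof (induction R)
  case empty
  show ?case by (intro exI[of _ id]) (simp add: strict_mono_def)
next
  case (insert r R)
  then obtain s :: "nat \<Rightarrow> nat" where s: "strict_mono s" "\<forall>r\<in>R. mono (f r \<circ> s)" by blast
  obtain t :: "nat \<Rightarrow> nat" where t: "strict_mono t" "mono ((f r \<circ> s) \<circ> t)"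
    using nat_mono_subsequence by blast
  have "strict_mono (s \<circ> t)" using s t by (auto simp: strict_mono_def)
  moreover have "mono (f r' \<circ> (s \<circ> t))" if "r' \<in> insert r R" for r'
    using that s(2) t by (auto simp: mono_def strict_mono_less_eq)
  ultimately show ?case by blast
qed

text \<open>
  If the chain did not stop, every \<open>L N\<close> would miss some \<open>a N\<close> that a later member contains. A good
  subsequence of \<open>a\<close> starts in a fixed member of the chain, so upward closure puts its late terms
  \<open>a N\<close> into \<open>L N\<close> after all.
\<close>

lemma upward_closed_chain_stationary:
  fixes L :: "nat \<Rightarrow> 'a set"
  assumes good: "\<And>a. \<exists>s :: nat \<Rightarrow> nat. strict_mono s \<and> (\<forall>i j. i \<le> j \<longrightarrow> P (a (s i)) (a (s j)))"
    and closed: "\<And>i x y. x \<in> L i \<Longrightarrow> P x y \<Longrightarrow> y \<in> L i"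
    and chain: "\<And>i. L i \<subseteq> L (Suc i)"
  shows "\<exists>N. \<forall>i\<ge>N. L i = L N"
proof (rule ccontr)
  assume "\<nexists>N. \<forall>i\<ge>N. L i = L N"
  moreover have inc: "L i \<subseteq> L j" if "i \<le> j" for i j
    using lift_Suc_mono_le[of L] chain that by blast
  ultimately have "\<forall>N. \<exists>i x. i \<ge> N \<and> x \<in> L i \<and> x \<notin> L N" by blast
  then obtain k a where ka: "\<And>N. a N \<in> L (k N)" "\<And>N. a N \<notin> L N" by metis
  obtain s :: "nat \<Rightarrow> nat" where s: "strict_mono s" "\<And>i j. i \<le> j \<Longrightarrow> P (a (s i)) (a (s j))"
    using good[of a] by auto
  let ?j = "k (s 0)"
  have "a (s 0) \<in> L (s ?j)"
    using ka(1)[of "s 0"] inc[of ?j "s ?j"] strict_mono_imp_increasing[OF s(1)] by blast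
  then have "a (s ?j) \<in> L (s ?j)" using closed s(2)[of 0 ?j] by blast
  then show False using ka(2) by blast
qed

section \<open>Rational cones and Dickson's lemma\<close>

lemma exponent_vector_add:
  "exponent_vector (\<alpha> + \<beta>) = exponent_vector \<alpha> + exponent_vector \<beta>"
  by (simp add: exponent_vector_def vec_eq_iff lookup_add)

lemma common_denominator:
  fixes Q :: "real set"
  assumes "finite Q" "Q \<subseteq> \<rat>"
  shows "\<exists>D::nat. D > 0 \<and> (\<forall>q\<in>Q. real D * q \<in> \<int>)"
  using assms
proof (induction Q)
  case empty
  show ?case by auto
next
  case (insert q Q)
  then obtain D :: nat where D: "D > 0" "\<And>q. q \<in> Q \<Longrightarrow> real D * q \<in> \<int>" by auto
  obtain a b :: int where ab: "b > 0" "q = of_int a / of_int b"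
    using insert.prems by (auto elim: Rats_cases')
  have "real (D * nat b) * q = of_int (int D * a)" using ab by simp
  then have "real (D * nat b) * q \<in> \<int>" by (metis Ints_of_int)
  moreover have "real (D * nat b) * q' \<in> \<int>" if "q' \<in> Q" for q'
  proof -
    have "real (D * nat b) * q' = of_int b * (real D * q')" using ab by simp
    then show ?thesis using D(2)[OF that] by (simp only: Ints_mult Ints_of_int)
  qed
  ultimately show ?case using D(1) ab(1) by (intro exI[of _ "D * nat b"]) auto
qed

lemma linear_form_expansion:
  fixes r :: "real ^ 'n::finite \<Rightarrow> real"
  assumes "linear r"
  shows "r v = (\<Sum>i\<in>UNIV. v $ i * r (axis i 1))"
proof -
  have "r v = r (\<Sum>i\<in>UNIV. v $ i *\<^sub>R axis i 1)"
    by (metis (no_types, lifting) basis_expansion scalar_mult_eq_scaleR sum.cong)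
  then show ?thesis using assms by (simp add: linear_sum linear_scale)
qed

text \<open>
  The values of a rational form on the translated lattice have a common denominator, which is where
  the rationality of both the cones and the translation vector enters.
\<close>

lemma rational_form_denominator:
  fixes r :: "real ^ 'n::finite \<Rightarrow> real"
  assumes r: "rational_linear_form r" and \<delta>: "\<And>i. \<delta> $ i \<in> \<rat>"
  shows "\<exists>D::nat. D > 0 \<and> (\<forall>\<alpha>. real D * r (exponent_vector \<alpha> + \<delta>) \<in> \<int>)"
proof -
  have lin: "linear r" and rat: "\<And>i. r (axis i 1) \<in> \<rat>"
    using r by (auto simp: rational_linear_form_def)
  have "r \<delta> \<in> \<rat>"
    by (subst linear_form_expansion[OF lin]) (intro Rats_sum Rats_mult \<delta> rat)
  then obtain D :: nat where D: "D > 0" "real D * r \<delta> \<in> \<int>" "\<And>i. real D * r (axis i 1) \<in> \<int>"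
    using common_denominator[of "insert (r \<delta>) (range (\<lambda>i. r (axis i 1)))"] rat by auto
  have "real D * r (exponent_vector \<alpha> + \<delta>) \<in> \<int>" for \<alpha>
  proof -
    have "r (exponent_vector \<alpha>)
        = (\<Sum>i\<in>UNIV. real (Poly_Mapping.lookup \<alpha> i) * r (axis i 1))"
      by (subst linear_form_expansion[OF lin]) (simp add: exponent_vector_def)
    then have "real D * r (exponent_vector \<alpha> + \<delta>)
        = (\<Sum>i\<in>UNIV. real (Poly_Mapping.lookup \<alpha> i) * (real D * r (axis i 1))) + real D * r \<delta>"
      by (simp add: linear_add[OF lin] sum_distrib_left algebra_simps)
    also have "\<dots> \<in> \<int>" by (intro Ints_add Ints_sum Ints_mult D Ints_of_nat)
    finally show ?thesis .
  qed
  then show ?thesis using D(1) by blast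
qed

text \<open>
  The translations of \<open>\<alpha>\<close> under which a leading monomial stays leading: those by a monomial of a cone
  that contains \<open>\<alpha> + \<delta>\<close>.
\<close>

definition cone_shift ::
    "(real ^ 'n::finite \<Rightarrow> real) set \<Rightarrow> real ^ 'n \<Rightarrow> 'n monomial \<Rightarrow> 'n monomial \<Rightarrow> bool" where
  "cone_shift F \<delta> \<alpha> \<gamma> \<longleftrightarrow> (\<exists>l\<in>F. \<exists>\<beta>. \<gamma> = \<alpha> + \<beta> \<and>
     exponent_vector \<alpha> + \<delta> \<in> min_cone F l \<and> exponent_vector \<beta> \<in> min_cone F l)"

lemma min_cones_cover:
  assumes "finite F" "F \<noteq> {}" "\<And>i. 0 \<le> v $ i"
  shows "\<exists>l\<in>F. v \<in> min_cone F l"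
proof -
  have "Min ((\<lambda>l. l v) ` F) \<in> (\<lambda>l. l v) ` F" using assms by (intro Min_in) auto
  then obtain l where "l \<in> F" "Min ((\<lambda>l. l v) ` F) = l v" by (rule imageE)
  then show ?thesis using assms(3) by (intro bexI[of _ l]) (simp_all add: min_cone_def)
qed

text \<open>
  A difference of exponent vectors in a cone is nonnegative, so it is again the exponent vector of
  a monomial.
\<close>

lemma exponent_difference_in_cone:
  assumes "exponent_vector \<gamma> - exponent_vector \<alpha> \<in> min_cone F l"
  obtains \<beta> where "\<gamma> = \<alpha> + \<beta>" "exponent_vector \<beta> \<in> min_cone F l"
proof -
  have "Poly_Mapping.lookup \<alpha> i \<le> Poly_Mapping.lookup \<gamma> i" for i
    using assms by (auto simp: min_cone_def exponent_vector_def)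
  then have eq: "\<gamma> = \<alpha> + (\<gamma> - \<alpha>)"
    by (intro poly_mapping_eqI) (simp add: lookup_add lookup_minus)
  have "exponent_vector (\<gamma> - \<alpha>) = exponent_vector \<gamma> - exponent_vector \<alpha>"
    by (subst (2) eq) (simp add: exponent_vector_add)
  then show ?thesis using that[OF eq] assms by simp
qed

lemma cone_shift_subsequence:
  fixes a :: "nat \<Rightarrow> 'n::finite monomial"
  assumes F: "finite F" "F \<noteq> {}" "rational_family F"
    and \<delta>: "\<And>i. \<delta> $ i \<in> \<rat> \<and> 0 \<le> \<delta> $ i"
  shows "\<exists>s :: nat \<Rightarrow> nat. strict_mono s \<and> (\<forall>i j. i \<le> j \<longrightarrow> cone_shift F \<delta> (a (s i)) (a (s j)))"
proof -
  define v where "v \<alpha> = exponent_vector \<alpha> + \<delta>" for \<alpha>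
  have "\<exists>l\<in>F. v (a n) \<in> min_cone F l" for n
    using \<delta> by (intro min_cones_cover F(1,2)) (simp add: v_def exponent_vector_def)
  then have "\<exists>l\<in>F. infinite {n \<in> UNIV. v (a n) \<in> min_cone F l}"
    using pigeonhole_infinite_rel[of UNIV F "\<lambda>n l. v (a n) \<in> min_cone F l"] F(1) by simp
  then obtain l where l: "l \<in> F" "infinite {n. v (a n) \<in> min_cone F l}" by auto
  obtain t :: "nat \<Rightarrow> nat" where t: "strict_mono t" "\<And>n. v (a (t n)) \<in> min_cone F l"
    using infinite_enumerate[OF l(2)] by auto
  obtain R where R: "finite R" "\<And>r. r \<in> R \<Longrightarrow> rational_linear_form r"
    and cone: "min_cone F l = {x. \<forall>r\<in>R. 0 \<le> r x}"
    using F(3) l(1) unfolding rational_family_def by meson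
  have "\<forall>r\<in>R. \<exists>D::nat. D > 0 \<and> (\<forall>\<alpha>. real D * r (v \<alpha>) \<in> \<int>)"
    using rational_form_denominator R(2) \<delta> unfolding v_def by blast
  then obtain D :: "_ \<Rightarrow> nat"
    where D: "\<And>r. r \<in> R \<Longrightarrow> D r > 0" "\<And>r \<alpha>. r \<in> R \<Longrightarrow> real (D r) * r (v \<alpha>) \<in> \<int>"
    by metis
  define h where "h r n = nat \<lfloor>real (D r) * r (v (a (t n)))\<rfloor>" for r n
  have h: "real (h r n) = real (D r) * r (v (a (t n)))" if "r \<in> R" for r n
  proof -
    have "0 \<le> r (v (a (t n)))" using t(2)[of n] that unfolding cone by auto
    then show ?thesis using D(2)[OF that] unfolding h_def by (simp add: of_nat_nat)
  qed
  obtain u :: "nat \<Rightarrow> nat" where u: "strict_mono u" "\<And>r. r \<in> R \<Longrightarrow> mono (h r \<circ> u)"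
    using Dickson_mono_subsequence[OF R(1), of h] by blast
  have "cone_shift F \<delta> (a (t (u i))) (a (t (u j)))" if "i \<le> j" for i j
  proof -
    have "0 \<le> r (exponent_vector (a (t (u j))) - exponent_vector (a (t (u i))))" if r: "r \<in> R" for r
    proof -
      have "real (h r (u i)) \<le> real (h r (u j))"
        using u(2)[OF r] \<open>i \<le> j\<close> by (auto simp: mono_def)
      then have "r (v (a (t (u i)))) \<le> r (v (a (t (u j))))"
        using D(1)[OF r] by (simp add: h[OF r])
      moreover have "linear r" using R(2)[OF r] by (simp add: rational_linear_form_def)
      ultimately show ?thesis by (simp add: v_def linear_add linear_diff)
    qed
    then have "exponent_vector (a (t (u j))) - exponent_vector (a (t (u i))) \<in> min_cone F l"
      by (simp add: cone)
    then obtain \<beta> where "a (t (u j)) = a (t (u i)) + \<beta>" "exponent_vector \<beta> \<in> min_cone F l"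
      by (rule exponent_difference_in_cone)
    then show ?thesis using l(1) t(2) unfolding cone_shift_def v_def by blast
  qed
  moreover have "strict_mono (t \<circ> u)" using t(1) u(1) by (simp add: strict_mono_o)
  ultimately show ?thesis by (intro exI[of _ "t \<circ> u"]) simp
qed

section \<open>Leading monomials under multiplication within a cone\<close>

lemma LM_eqI:
  assumes prec: "total_ordering prec" and m: "m \<in> Poly_Mapping.keys f"
    and max: "\<And>m'. m' \<in> Poly_Mapping.keys f \<Longrightarrow> m' \<noteq> m \<Longrightarrow> prec m' m"
  shows "LM prec f = m"
  unfolding LM_def
proof (rule the_equality)
  fix m' assume m': "m' \<in> Poly_Mapping.keys f \<and> (\<forall>k\<in>Poly_Mapping.keys f. k \<noteq> m' \<longrightarrow> prec k m')"
  show "m' = m"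
  proof (rule ccontr)
    assume "m' \<noteq> m"
    then have "prec m m'" "prec m' m" using m m' max by auto
    then show False using prec by (meson total_ordering_def irreflpD transpD)
  qed
qed (use m max in blast)

lemma LM_greatest:
  assumes prec: "total_ordering prec" and "f \<noteq> 0"
  shows "LM prec f \<in> Poly_Mapping.keys f"
    and "m \<in> Poly_Mapping.keys f \<Longrightarrow> m \<noteq> LM prec f \<Longrightarrow> prec m (LM prec f)"
proof -
  have "\<exists>m\<in>A. \<forall>m'\<in>A. m' \<noteq> m \<longrightarrow> prec m' m" if "finite A" "A \<noteq> {}" for A
    using that
  proof (induction rule: finite_ne_induct)
    case (singleton x)
    then show ?case by simp
  next
    case (insert x A)
    then obtain m where m: "m \<in> A" "\<And>m'. m' \<in> A \<Longrightarrow> m' \<noteq> m \<Longrightarrow> prec m' m" by blast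
    have tr: "\<And>a b c. prec a b \<Longrightarrow> prec b c \<Longrightarrow> prec a c"
      using prec by (auto simp: total_ordering_def dest: transpD)
    have "x \<noteq> m" using m(1) insert.hyps by blast
    then have "prec x m \<or> prec m x"
      using prec by (auto simp: total_ordering_def totalp_on_def)
    then show ?case
    proof (elim disjE)
      assume "prec x m"
      then show ?thesis using m by (intro bexI[of _ m]) auto
    next
      assume "prec m x"
      then have "prec m' x" if "m' \<in> A" for m' using m(2)[OF that] tr by (cases "m' = m") blast+
      then show ?thesis by blast
    qed
  qed
  then obtain m0 where m0: "m0 \<in> Poly_Mapping.keys f"
    "\<And>m'. m' \<in> Poly_Mapping.keys f \<Longrightarrow> m' \<noteq> m0 \<Longrightarrow> prec m' m0"
    using \<open>f \<noteq> 0\<close> by (metis finite_keys keys_eq_empty)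
  moreover have "LM prec f = m0" using LM_eqI[OF prec] m0 by blast
  ultimately show "LM prec f \<in> Poly_Mapping.keys f"
    and "m \<in> Poly_Mapping.keys f \<Longrightarrow> m \<noteq> LM prec f \<Longrightarrow> prec m (LM prec f)" by auto
qed

lemma keys_monomial_times:
  fixes f :: "('n, 'k::field) mpoly"
  shows "Poly_Mapping.keys (Poly_Mapping.single \<beta> 1 * f) = (+) \<beta> ` Poly_Mapping.keys f"
proof -
  have lk: "Poly_Mapping.lookup (Poly_Mapping.single \<beta> 1 * f) k
      = (\<Sum>q. (Poly_Mapping.lookup f q when k = \<beta> + q))" for k
    by (simp add: lookup_mult lookup_single when_mult)
  have shifted: "\<beta> + \<gamma> \<in> Poly_Mapping.keys (Poly_Mapping.single \<beta> 1 * f)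
      \<longleftrightarrow> \<gamma> \<in> Poly_Mapping.keys f" for \<gamma>
    by (simp add: in_keys_iff lk)
  have range: "k \<in> range ((+) \<beta>)"
    if "k \<in> Poly_Mapping.keys (Poly_Mapping.single \<beta> 1 * f)" for k
  proof (rule ccontr)
    assume "k \<notin> range ((+) \<beta>)"
    then have "\<And>q. k \<noteq> \<beta> + q" by blast
    then show False using that by (simp add: in_keys_iff lk)
  qed
  show ?thesis
  proof (intro equalityI subsetI)
    fix k assume k: "k \<in> Poly_Mapping.keys (Poly_Mapping.single \<beta> 1 * f)"
    then obtain \<gamma> where "k = \<beta> + \<gamma>" using range by blast
    then show "k \<in> (+) \<beta> ` Poly_Mapping.keys f" using k shifted by simp
  next
    fix k assume "k \<in> (+) \<beta> ` Poly_Mapping.keys f"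
    then show "k \<in> Poly_Mapping.keys (Poly_Mapping.single \<beta> 1 * f)" using shifted by auto
  qed
qed

lemma monomial_times_nonzero:
  fixes f :: "('n, 'k::field) mpoly"
  assumes "f \<noteq> 0"
  shows "Poly_Mapping.single \<beta> 1 * f \<noteq> 0"
  using assms keys_monomial_times[of \<beta> f] by (metis image_is_empty keys_eq_empty)

definition min_form :: "(real ^ 'n::finite \<Rightarrow> real) set \<Rightarrow> real ^ 'n \<Rightarrow> real" where
  "min_form F v = Min ((\<lambda>l. l v) ` F)"

lemma min_form_superadditive:
  assumes F: "finite F" "F \<noteq> {}" and lin: "\<And>l. l \<in> F \<Longrightarrow> linear l"
  shows "min_form F u + min_form F v \<le> min_form F (u + v)"
proof -
  have "min_form F u + min_form F v \<le> l (u + v)" if "l \<in> F" for l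
    using F that by (auto simp: min_form_def linear_add[OF lin] intro!: add_mono Min_le)
  then show ?thesis using F unfolding min_form_def[of F "u + v"] by simp
qed

lemma min_form_additive_on_cone:
  assumes F: "finite F" and lin: "\<And>l. l \<in> F \<Longrightarrow> linear l"
    and l: "l \<in> F" "u \<in> min_cone F l" "v \<in> min_cone F l"
  shows "min_form F (u + v) = min_form F u + min_form F v"
proof (rule antisym)
  have "min_form F (u + v) \<le> l (u + v)" using F l(1) by (auto simp: min_form_def)
  also have "\<dots> = min_form F u + min_form F v"
    using l by (simp add: linear_add[OF lin] min_form_def min_cone_def)
  finally show "min_form F (u + v) \<le> min_form F u + min_form F v" .
  show "min_form F u + min_form F v \<le> min_form F (u + v)"
    using min_form_superadditive[OF F _ lin] l(1) by blast
qed

lemma newton_weight_min_form: "newton_weight F \<delta> \<alpha> = min_form F (exponent_vector \<alpha> + \<delta>)"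
  by (simp add: newton_weight_def min_form_def)

text \<open>
  The monomial \<open>\<alpha>\<close> gains \<open>min_form F \<beta>\<close> exactly and every competitor \<open>\<gamma>\<close> at least that much. So \<open>\<gamma>\<close> can
  only tie with \<open>\<alpha>\<close> after the shift if it did so before, and ties are decided by an ordering
  compatible with multiplication.
\<close>

lemma newton_less_shift:
  assumes F: "finite F" and lin: "\<And>l. l \<in> F \<Longrightarrow> linear l"
    and l: "l \<in> F" "exponent_vector \<alpha> + \<delta> \<in> min_cone F l" "exponent_vector \<beta> \<in> min_cone F l"
    and prec0: "semigroup_ordering prec0"
    and prec: "\<And>a b. prec a b \<longleftrightarrow> newton_weight F \<delta> a > newton_weight F \<delta> b \<or>
           newton_weight F \<delta> a = newton_weight F \<delta> b \<and> prec0 a b"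
    and less: "prec \<gamma> \<alpha>"
  shows "prec (\<beta> + \<gamma>) (\<beta> + \<alpha>)"
proof -
  have shift: "exponent_vector (\<beta> + \<mu>) + \<delta> = (exponent_vector \<mu> + \<delta>) + exponent_vector \<beta>" for \<mu>
    by (simp add: exponent_vector_add)
  have "newton_weight F \<delta> (\<beta> + \<alpha>) = newton_weight F \<delta> \<alpha> + min_form F (exponent_vector \<beta>)"
    unfolding newton_weight_min_form shift by (rule min_form_additive_on_cone[OF F lin l])
  moreover have "newton_weight F \<delta> \<gamma> + min_form F (exponent_vector \<beta>) \<le> newton_weight F \<delta> (\<beta> + \<gamma>)"
    unfolding newton_weight_min_form shift
    using min_form_superadditive[OF F _ lin] l(1) by blast
  moreover have "prec0 \<gamma> \<alpha> \<Longrightarrow> prec0 (\<beta> + \<gamma>) (\<beta> + \<alpha>)"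
    using prec0 by (metis semigroup_ordering_def add.commute)
  ultimately show ?thesis using less unfolding prec by linarith
qed

lemma LM_shift:
  fixes f :: "('n, 'k::field) mpoly"
  assumes prec: "total_ordering prec" and "f \<noteq> 0"
    and less: "\<And>\<gamma>. prec \<gamma> (LM prec f) \<Longrightarrow> prec (\<beta> + \<gamma>) (\<beta> + LM prec f)"
  shows "LM prec (Poly_Mapping.single \<beta> 1 * f) = \<beta> + LM prec f"
proof (rule LM_eqI[OF prec])
  show "\<beta> + LM prec f \<in> Poly_Mapping.keys (Poly_Mapping.single \<beta> 1 * f)"
    using LM_greatest(1)[OF prec \<open>f \<noteq> 0\<close>] by (simp add: keys_monomial_times)
next
  fix m assume "m \<in> Poly_Mapping.keys (Poly_Mapping.single \<beta> 1 * f)" and ne: "m \<noteq> \<beta> + LM prec f"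
  then obtain \<gamma> where "\<gamma> \<in> Poly_Mapping.keys f" "m = \<beta> + \<gamma>" by (auto simp: keys_monomial_times)
  then show "prec m (\<beta> + LM prec f)"
    using ne less LM_greatest(2)[OF prec \<open>f \<noteq> 0\<close>] by blast
qed

text \<open>
  Both kinds of lead monomial sets consist of the leading monomials of a set of polynomials that is
  closed under multiplication by monomials.
\<close>

lemma lead_monomial_set_multiples:
  assumes "lead_monomial_set TYPE('k::field) prec S" "\<alpha> \<in> S"
  obtains f :: "('n, 'k::field) mpoly" where "f \<noteq> 0" "LM prec f = \<alpha>"
    "\<And>\<beta>. LM prec (Poly_Mapping.single \<beta> 1 * f) \<in> S"
proof -
  consider (gen) G :: "('n, 'k) mpoly set" where "S = lead_of_finite prec G"
    | (ideal) I :: "('n, 'k) mpoly set" where "poly_ideal I" "S = lead_of_ideal prec I"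
    using assms(1) unfolding lead_monomial_set_def by auto
  then show ?thesis
  proof cases
    case gen
    then obtain \<mu> g where g: "g \<in> G" "g \<noteq> 0" "\<alpha> = LM prec (Poly_Mapping.single \<mu> 1 * g)"
      using assms(2) by (auto simp: lead_of_finite_def)
    have "LM prec (Poly_Mapping.single \<beta> 1 * (Poly_Mapping.single \<mu> 1 * g)) \<in> S" for \<beta>
    proof -
      have "Poly_Mapping.single \<beta> 1 * (Poly_Mapping.single \<mu> 1 * g)
          = Poly_Mapping.single (\<beta> + \<mu>) 1 * g"
        by (simp add: mult.assoc[symmetric] mult_single)
      then show ?thesis using g(1,2) unfolding gen lead_of_finite_def by auto
    qed
    then show ?thesis using that[OF monomial_times_nonzero[OF g(2)]] g(3) by simp
  next
    case ideal
    then obtain f where f: "f \<in> I" "f \<noteq> 0" "\<alpha> = LM prec f"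
      using assms(2) by (auto simp: lead_of_ideal_def)
    have "LM prec (Poly_Mapping.single \<beta> 1 * f) \<in> S" for \<beta>
    proof -
      have "Poly_Mapping.single \<beta> 1 * f \<in> I"
        using ideal(1) f(1) unfolding poly_ideal_iff by simp
      then show ?thesis
        using monomial_times_nonzero[OF f(2)] unfolding ideal(2) lead_of_ideal_def by blast
    qed
    then show ?thesis using that f by simp
  qed
qed

theorem proposition3p5:
  fixes prec :: "'n::finite monomial \<Rightarrow> 'n monomial \<Rightarrow> bool"
  assumes "newton_ordering prec"
  shows "noetherian_ordering TYPE('k::field) prec"
proof -
  obtain F \<delta> prec0 where F: "finite F" "F \<noteq> {}" "rational_family F"
    and lin: "\<And>l. l \<in> F \<Longrightarrow> linear l"
    and \<delta>: "\<And>i. \<delta> $ i \<in> \<rat> \<and> 0 \<le> \<delta> $ i"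
    and prec0: "semigroup_ordering prec0"
    and prec: "\<And>a b. prec a b \<longleftrightarrow> newton_weight F \<delta> a > newton_weight F \<delta> b \<or>
           newton_weight F \<delta> a = newton_weight F \<delta> b \<and> prec0 a b"
    using assms unfolding newton_ordering_def by blast
  note total = newton_ordering_total[OF assms]
  have closed: "\<gamma> \<in> S"
    if S: "lead_monomial_set TYPE('k) prec S" and "\<alpha> \<in> S" and shift: "cone_shift F \<delta> \<alpha> \<gamma>"
    for S :: "'n monomial set" and \<alpha> \<gamma>
  proof -
    obtain f :: "('n, 'k) mpoly" where f: "f \<noteq> 0" "LM prec f = \<alpha>"
      "\<And>\<beta>. LM prec (Poly_Mapping.single \<beta> 1 * f) \<in> S"
      using lead_monomial_set_multiples[OF S \<open>\<alpha> \<in> S\<close>] by blast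
    obtain l \<beta> where l: "l \<in> F" "exponent_vector \<alpha> + \<delta> \<in> min_cone F l"
        "exponent_vector \<beta> \<in> min_cone F l" and \<gamma>: "\<gamma> = \<alpha> + \<beta>"
      using shift unfolding cone_shift_def by blast
    have "LM prec (Poly_Mapping.single \<beta> 1 * f) = \<beta> + \<alpha>"
      using LM_shift[OF total f(1)] newton_less_shift[OF F(1) lin l prec0 prec] f(2) by blast
    then show ?thesis using f(3)[of \<beta>] \<gamma> by (simp add: add.commute)
  qed
  show ?thesis
    unfolding noetherian_ordering_def
  proof (intro allI impI)
    fix L :: "nat \<Rightarrow> 'n monomial set"
    assume L: "(\<forall>i. lead_monomial_set TYPE('k) prec (L i)) \<and> (\<forall>i. L i \<subseteq> L (Suc i))"
    show "\<exists>N. \<forall>i\<ge>N. L i = L N"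
    proof (rule upward_closed_chain_stationary)
      show "\<exists>s :: nat \<Rightarrow> nat. strict_mono s \<and> (\<forall>i j. i \<le> j \<longrightarrow> cone_shift F \<delta> (a (s i)) (a (s j)))" for a
        using F \<delta> by (rule cone_shift_subsequence)
      show "\<gamma> \<in> L i" if "\<alpha> \<in> L i" "cone_shift F \<delta> \<alpha> \<gamma>" for i \<alpha> \<gamma>
        using closed[OF _ that] L by simp
      show "L i \<subseteq> L (Suc i)" for i using L by simp
    qed
  qed
qed

end
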